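(* Let $S$ be a numerical semigroup with multiplicity $m = 5$. Then the set of decomposition lengths of $S$ into irreducibles is an interval.
   Context: A numerical semigroup is a subset of $\mathbb{Z}_{\ge 0}$ that contains $0$, is closed under addition, and has finite complement in $\mathbb{Z}_{\ge 0}$. The multiplicity of a numerical semigroup is its smallest positive element. A numerical semigroup is irreducible if it cannot be expressed as the intersection of two numerical semigroups properly containing it. A decomposition of $S$ into irreducibles is an expression $S = S_1 \cap \cdots \cap S_k$ with each $S_i$ an irreducible numerical semigroup, which is irredundant: $S \ne \bigcap_{i \in I} S_i$ for every proper subset $I \subsetneq \{1,\dots,k\}$. The number $k$ is the length of the decomposition. The set of decomposition lengths of $S$ is the set of all $k$ for which $S$ has a decomposition into irreducibles of length $k$. A set of integers is an interval if it has the form $\{n \in \mathbb{Z} : a \le n \le b\}$ for some integers $a \le b$. *)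

theory Defs
  imports Main
begin

definition numerical_semigroup :: "nat set \<Rightarrow> bool" where
  "numerical_semigroup S \<longleftrightarrow>
     0 \<in> S \<and> (\<forall>x\<in>S. \<forall>y\<in>S. x + y \<in> S) \<and> finite (- S)"

definition multiplicity :: "nat set \<Rightarrow> nat" where
  "multiplicity S = (LEAST n. 0 < n \<and> n \<in> S)"

definition irreducible_semigroup :: "nat set \<Rightarrow> bool" where
  "irreducible_semigroup S \<longleftrightarrow> numerical_semigroup S \<and>
     \<not> (\<exists>T U. numerical_semigroup T \<and> numerical_semigroup U \<and>
              S \<subset> T \<and> S \<subset> U \<and> S = T \<inter> U)"

(* The empty intersection is UNIV, the semigroup of all natural numbers.  This
   convention only affects S = UNIV, whose sole decomposition is then the empty
   one; every other S has only decompositions with k >= 1, and for it the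
   irredundancy condition holds trivially at the empty index set. *)
definition irreducible_decomposition :: "nat set \<Rightarrow> nat \<Rightarrow> (nat \<Rightarrow> nat set) \<Rightarrow> bool" where
  "irreducible_decomposition S k T \<longleftrightarrow>
     (\<forall>i\<in>{1..k}. irreducible_semigroup (T i)) \<and>
     S = (\<Inter>i\<in>{1..k}. T i) \<and>
     (\<forall>I. I \<subset> {1..k} \<longrightarrow> S \<noteq> (\<Inter>i\<in>I. T i))"

definition decomposition_lengths :: "nat set \<Rightarrow> nat set" where
  "decomposition_lengths S = {k. \<exists>T. irreducible_decomposition S k T}"

definition integer_interval :: "int set \<Rightarrow> bool" where
  "integer_interval A \<longleftrightarrow> (\<exists>a b. a \<le> b \<and> A = {n. a \<le> n \<and> n \<le> b})"

end

theory Submission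
  imports Defs
begin

text \<open>
  Call a gap h of S special if adjoining h to S gives a semigroup again. The largest element of a
  proper oversemigroup outside S is special, so oversemigroups intersect in S iff every special gap
  is missed by one of them: decompositions are irredundant covers of the set of special gaps. Now
  let 5 be in S. Special gaps have distinct nonzero residues mod 5, so there are at most four of
  them. If an irreducible oversemigroup T with largest gap F misses special gaps h and h', then
  h + h' is not congruent to F mod 5, by the symmetry of T under reflection in F; hence T
  misses at most two special gaps. So with n special gaps all lengths lie between n/2 and n, and
  the only possible hole is 3 when n = 4 and both 2 and 4 occur. Then a member of the decomposition
  of length 2 and two suitable members of that of length 4 give one of length 3.
\<close>

section \<open>Special gaps and intersections of oversemigroups\<close>

definition special_gaps :: "nat set \<Rightarrow> nat set" where
  "special_gaps S = {h. h \<notin> S \<and> h + h \<in> S \<and> (\<forall>s\<in>S. 0 < s \<longrightarrow> h + s \<in> S)}"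

lemma numerical_semigroup_add_mult:
  assumes "numerical_semigroup S" "a \<in> S" "x \<in> S"
  shows "x + a * k \<in> S"
proof (induction k)
  case 0
  show ?case using assms by simp
next
  case (Suc k)
  have "x + a * Suc k = (x + a * k) + a" by simp
  then show ?case using Suc assms unfolding numerical_semigroup_def by metis
qed

lemma numerical_semigroup_mod_eq:
  assumes "numerical_semigroup S" "a \<in> S" "x \<in> S" "x \<le> y" "x mod a = y mod a"
  shows "y \<in> S"
proof -
  obtain k where "y = x + a * k"
    using assms(4,5) by (metis mod_eq_nat2E)
  then show ?thesis using numerical_semigroup_add_mult[OF assms(1-3)] by simp
qed

lemma numerical_semigroup_insert_special_gap:
  assumes "numerical_semigroup S" "h \<in> special_gaps S"
  shows "numerical_semigroup (insert h S)"
proof -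
  have "x + y \<in> insert h S" if "x \<in> insert h S" "y \<in> insert h S" for x y
    using that assms unfolding numerical_semigroup_def special_gaps_def
    by (cases "x = 0"; cases "y = 0") (auto simp: add.commute)
  moreover have "finite (- insert h S)"
    using assms unfolding numerical_semigroup_def by (auto intro: finite_subset[of _ "- S"])
  ultimately show ?thesis using assms unfolding numerical_semigroup_def by blast
qed

text \<open>Adjoining two different special gaps separately would give two proper oversemigroups
  that meet exactly in \<open>T\<close>.\<close>

lemma irreducible_special_gap_unique:
  assumes "irreducible_semigroup T" "g \<in> special_gaps T" "h \<in> special_gaps T"
  shows "g = h"
proof (rule ccontr)
  assume "g \<noteq> h"
  moreover have "g \<notin> T" "h \<notin> T" using assms unfolding special_gaps_def by auto
  ultimately have "T = insert g T \<inter> insert h T" "T \<subset> insert g T" "T \<subset> insert h T" by auto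
  moreover have "numerical_semigroup (insert g T)" "numerical_semigroup (insert h T)"
    using assms numerical_semigroup_insert_special_gap
    unfolding irreducible_semigroup_def by auto
  ultimately show False using assms(1) unfolding irreducible_semigroup_def by blast
qed

text \<open>The largest element \<open>h\<close> of \<open>V - S\<close> works: adding to it
  \<open>h\<close> or a positive element of \<open>S\<close> gives a larger element of
  \<open>V\<close>, which must lie in \<open>S\<close>.\<close>

lemma special_gap_in_oversemigroup:
  assumes "numerical_semigroup S" "S \<subset> V" and add: "\<And>x y. x \<in> V \<Longrightarrow> y \<in> V \<Longrightarrow> x + y \<in> V"
  shows "\<exists>h\<in>special_gaps S. h \<in> V"
proof -
  define h where "h = Max (V - S)"
  have fin: "finite (V - S)"
    using assms(1) unfolding numerical_semigroup_def by (auto intro: finite_subset[of _ "- S"])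
  have h: "h \<in> V - S" unfolding h_def using fin assms(2) by (intro Max_in) auto
  have larger: "x \<in> S" if "x \<in> V" "h < x" for x
    using Max_ge[OF fin, of x] that unfolding h_def by force
  have "h \<noteq> 0" using h assms(1) unfolding numerical_semigroup_def by (metis DiffE)
  then have "h \<in> special_gaps S"
    using h larger add assms(2) unfolding special_gaps_def by auto
  then show ?thesis using h by blast
qed

text \<open>An intersection strictly larger than \<open>S\<close> is still closed under addition, so
  it contains a special gap. This turns decompositions into covers of the special gaps; the empty
  family is included, with intersection \<open>UNIV\<close>.\<close>

lemma Inter_eq_iff_special_gaps:
  assumes "numerical_semigroup S" "\<And>T. T \<in> C \<Longrightarrow> numerical_semigroup T \<and> S \<subseteq> T"
  shows "\<Inter>C = S \<longleftrightarrow> (\<forall>h\<in>special_gaps S. \<exists>T\<in>C. h \<notin> T)"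
proof
  assume "\<Inter>C = S"
  then show "\<forall>h\<in>special_gaps S. \<exists>T\<in>C. h \<notin> T" unfolding special_gaps_def by blast
next
  assume *: "\<forall>h\<in>special_gaps S. \<exists>T\<in>C. h \<notin> T"
  show "\<Inter>C = S"
  proof (rule ccontr)
    assume "\<Inter>C \<noteq> S"
    then have "S \<subset> \<Inter>C" using assms(2) by blast
    moreover have "x + y \<in> \<Inter>C" if "x \<in> \<Inter>C" "y \<in> \<Inter>C" for x y
      using that assms(2) unfolding numerical_semigroup_def by blast
    ultimately obtain h where "h \<in> special_gaps S" "h \<in> \<Inter>C"
      using special_gap_in_oversemigroup[OF assms(1)] by metis
    then show False using * by blast
  qed
qed

section \<open>The largest gap of an irreducible semigroup\<close>

lemma Frobenius_special_gap:
  assumes "numerical_semigroup T" "F \<notin> T" "\<And>x. x \<notin> T \<Longrightarrow> x \<le> F"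
  shows "F \<in> special_gaps T"
proof -
  have "F \<noteq> 0" using assms unfolding numerical_semigroup_def by metis
  then show ?thesis using assms(2,3) unfolding special_gaps_def by (force simp: not_le)
qed

text \<open>If some \<open>g\<close> and \<open>F - g\<close> were both gaps, the largest gap above
  half of \<open>F\<close> in such a pair would be a special gap other than \<open>F\<close>,
  against irreducibility. The excluded case \<open>2 * g = F\<close> is the fixed point of the
  reflection.\<close>

lemma irreducible_reflection:
  assumes irr: "irreducible_semigroup T"
    and F: "F \<notin> T" "\<And>x. x \<notin> T \<Longrightarrow> x \<le> F"
    and g: "g \<notin> T" "2 * g \<noteq> F"
  shows "F - g \<in> T"
proof (rule ccontr)
  assume Fg: "F - g \<notin> T"
  have ns: "numerical_semigroup T" using irr unfolding irreducible_semigroup_def by simp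
  have zero: "0 \<in> T" and add: "\<And>x y. x \<in> T \<Longrightarrow> y \<in> T \<Longrightarrow> x + y \<in> T"
    using ns unfolding numerical_semigroup_def by auto
  define B where "B = {x. x \<notin> T \<and> F - x \<notin> T \<and> F < 2 * x}"
  have "finite B"
    using ns unfolding B_def numerical_semigroup_def by (auto intro: finite_subset[of _ "- T"])
  have "g \<le> F" using F(2) g(1) .
  \<comment> \<open>As \<open>2 * g \<noteq> F\<close>, one of the two lies strictly above half of
    \<open>F\<close>.\<close>
  then have "g \<in> B \<or> F - g \<in> B" unfolding B_def using g Fg by auto
  then have "B \<noteq> {}" by blast
  define m where "m = Max B"
  have m: "m \<in> B" unfolding m_def using \<open>finite B\<close> \<open>B \<noteq> {}\<close> by (rule Max_in)
  have max: "x \<notin> B" if "m < x" for x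
    using Max_ge[OF \<open>finite B\<close>, of x] that unfolding m_def by force
  have "m + m \<in> T" using F(2)[of "m + m"] m unfolding B_def by force
  moreover have "m + t \<in> T" if t: "t \<in> T" "0 < t" for t
  proof (rule ccontr)
    assume mt: "m + t \<notin> T"
    have le: "m + t \<le> F" using F(2) mt .
    \<comment> \<open>Otherwise adding \<open>t\<close> would put \<open>F - m\<close> into
      \<open>T\<close>. So \<open>m + t\<close> is again in \<open>B\<close>, against the maximality
      of \<open>m\<close>.\<close>
    have "F - (m + t) \<notin> T"
    proof
      assume "F - (m + t) \<in> T"
      then have "F - (m + t) + t \<in> T" using add t by blast
      moreover have "F - (m + t) + t = F - m" using le by simp
      ultimately show False using m unfolding B_def by simp
    qed
    then have "m + t \<in> B" unfolding B_def using mt m unfolding B_def by auto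
    then show False using max[of "m + t"] t by simp
  qed
  ultimately have "m \<in> special_gaps T" using m unfolding special_gaps_def B_def by auto
  then have "m = F"
    using irreducible_special_gap_unique[OF irr] Frobenius_special_gap[OF ns F] by blast
  \<comment> \<open>\<open>F\<close> is not in \<open>B\<close>, because \<open>F - F = 0\<close>
    lies in \<open>T\<close>.\<close>
  then show False using m zero unfolding B_def by simp
qed

text \<open>If the residues agreed, \<open>F - h\<close> would be an element of \<open>T\<close>
  congruent to the gap \<open>h'\<close>, hence \<open>h'\<close> plus a positive multiple of
  \<open>a\<close>. That number lies in \<open>S\<close>, and adding it to the special gap
  \<open>h\<close> would put \<open>F\<close> into \<open>S\<close>. The case \<open>h = h'\<close>
  is included.\<close>

lemma irreducible_missed_special_gaps_mod:
  assumes S: "numerical_semigroup S" "a \<in> S" "0 < a"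
    and T: "irreducible_semigroup T" "S \<subseteq> T"
    and F: "F \<notin> T" "\<And>x. x \<notin> T \<Longrightarrow> x \<le> F"
    and h: "h \<in> special_gaps S - T" and h': "h' \<in> special_gaps S - T"
  shows "(h + h') mod a \<noteq> F mod a"
proof
  assume cong: "(h + h') mod a = F mod a"
  have ns: "numerical_semigroup T" using T unfolding irreducible_semigroup_def by simp
  \<comment> \<open>This excludes the fixed point of the reflection, so that \<open>F - h\<close>
    lies in \<open>T\<close>.\<close>
  have "h + h \<in> T" using h T unfolding special_gaps_def by auto
  then have "2 * h \<noteq> F" using F(1) by (metis mult_2)
  then have FhT: "F - h \<in> T" using irreducible_reflection[OF T(1) F] h by blast
  have le: "h \<le> F" using F(2) h by blast
  have cong': "(F - h) mod a = h' mod a"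
  proof -
    have "(int h + int h') mod int a = int F mod int a"
      using cong by (metis of_nat_add of_nat_mod)
    then have "(int h + int h' - int h) mod int a = (int F - int h) mod int a"
      by (rule mod_diff_cong) simp
    then have "int h' mod int a = int (F - h) mod int a" using le by (simp add: of_nat_diff)
    then show ?thesis by (metis of_nat_eq_iff of_nat_mod)
  qed
  \<comment> \<open>From \<open>F - h\<close> on, \<open>T\<close> contains every number of this
    residue class, so the gap \<open>h'\<close> must come earlier.\<close>
  have lt: "h' < F - h"
  proof (rule ccontr)
    assume "\<not> h' < F - h"
    then have "h' \<in> T"
      using numerical_semigroup_mod_eq[OF ns _ FhT _ cong'] S T by auto
    then show False using h' by blast
  qed
  then obtain k where k: "F - h = h' + a * k" using cong' by (metis less_imp_le mod_eq_nat2E)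
  \<comment> \<open>Positivity of \<open>k\<close> matters: \<open>h'\<close> is a gap of
    \<open>S\<close>, but \<open>h' + a\<close> lies in \<open>S\<close>.\<close>
  then have "0 < k" using lt by (cases k) auto
  then obtain j where "k = Suc j" by (cases k) auto
  then have eq: "F = h + (h' + a + a * j)" using k le by simp
  have "h' + a \<in> S" using h' S unfolding special_gaps_def by blast
  then have t: "h' + a + a * j \<in> S" using numerical_semigroup_add_mult[OF S(1,2)] by blast
  have "\<forall>s\<in>S. 0 < s \<longrightarrow> h + s \<in> S" using h unfolding special_gaps_def by simp
  from bspec[OF this t] have "F \<in> S" using S(3) unfolding eq by simp
  then show False using F(1) T by blast
qed

section \<open>Residues of special gaps\<close>

lemma special_gaps_inj_on_mod:
  assumes "numerical_semigroup S" "a \<in> S"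
  shows "inj_on (\<lambda>h. h mod a) (special_gaps S)"
proof -
  have less: False
    if g: "g \<in> special_gaps S" and h: "h \<in> special_gaps S"
      and lt: "g < h" "g mod a = h mod a" for g h
  proof -
    \<comment> \<open>The difference \<open>a * k\<close> is a positive element of \<open>S\<close>,
      so adding it to the special gap \<open>g\<close> lands in \<open>S\<close>.\<close>
    obtain k where k: "h = g + a * k" using lt by (metis less_imp_le mod_eq_nat2E)
    then have "0 < a * k" using lt(1) by simp
    moreover have "a * k \<in> S"
      using numerical_semigroup_add_mult[OF assms, of 0 k] assms unfolding numerical_semigroup_def
      by simp
    ultimately have "h \<in> S" using g k unfolding special_gaps_def by blast
    then show False using h unfolding special_gaps_def by blast
  qed
  show ?thesis by (rule inj_onI) (metis less linorder_neqE_nat)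
qed

lemma special_gaps_mod_nonzero:
  assumes "numerical_semigroup S" "a \<in> S" "h \<in> special_gaps S"
  shows "h mod a \<noteq> 0"
proof
  assume "h mod a = 0"
  then have "h \<in> S"
    using numerical_semigroup_mod_eq[OF assms(1,2), of 0 h] assms(1)
    unfolding numerical_semigroup_def by simp
  then show False using assms(3) unfolding special_gaps_def by blast
qed

lemma finite_special_gaps:
  assumes "numerical_semigroup S"
  shows "finite (special_gaps S)"
  using assms unfolding numerical_semigroup_def special_gaps_def
  by (auto intro: finite_subset[of _ "- S"])

section \<open>Counting special gaps when 5 lies in the semigroup\<close>

lemma card_special_gaps_le_4:
  assumes "numerical_semigroup S" "5 \<in> S"
  shows "card (special_gaps S) \<le> 4"
proof -
  have "(\<lambda>h. h mod 5) ` special_gaps S \<subseteq> {1..4}"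
  proof
    fix r assume "r \<in> (\<lambda>h. h mod 5) ` special_gaps S"
    then have "r < 5" "r \<noteq> 0" using special_gaps_mod_nonzero[OF assms] by auto
    then show "r \<in> {1..4}" by simp
  qed
  then have "card ((\<lambda>h. h mod 5) ` special_gaps S) \<le> card {1..4::nat}"
    by (intro card_mono) auto
  then show ?thesis using card_image[OF special_gaps_inj_on_mod[OF assms]] by simp
qed

text \<open>\<open>R\<close> cannot contain both \<open>x\<close> and \<open>r - x\<close> mod 5,
  nor a fixed point of this involution. For \<open>r = 0\<close> the nonzero residues form two
  pairs, each of which loses an element. For other \<open>r\<close>, the residue \<open>r\<close> is
  paired with 0, the fixed point is excluded, and the remaining pair loses an element. Either way
  two of the four residues are absent.\<close>

lemma card_residues_sum_avoiding_le_2: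
  fixes R :: "nat set" and r :: nat
  assumes R: "R \<subseteq> {1..4}" and r: "r < 5" and avoid: "\<And>a b. a \<in> R \<Longrightarrow> b \<in> R \<Longrightarrow> (a + b) mod 5 \<noteq> r"
  shows "card R \<le> 2"
proof -
  have excl: "card R \<le> 2" if "x \<notin> R" "y \<notin> R" "x \<in> {1..4}" "y \<in> {1..4}" "x \<noteq> y" for x y
  proof -
    have "card R \<le> card ({1..4} - {x, y})"
      using R that by (intro card_mono) auto
    also have "\<dots> = 2" using that by (subst card_Diff_subset) auto
    finally show ?thesis .
  qed
  note av = avoid[of 1 1] avoid[of 1 2] avoid[of 1 3] avoid[of 1 4] avoid[of 2 2]
    avoid[of 2 3] avoid[of 2 4] avoid[of 3 3] avoid[of 3 4] avoid[of 4 4]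
  consider "r = 0" | "r = 1" | "r = 2" | "r = 3" | "r = 4" using r by linarith
  then show ?thesis
  proof cases
    case 1
    then have "1 \<notin> R \<or> 4 \<notin> R" "2 \<notin> R \<or> 3 \<notin> R" using av by auto
    then show ?thesis using excl[of 1 2] excl[of 1 3] excl[of 4 2] excl[of 4 3] by auto
  next
    case 2
    then have "3 \<notin> R" "2 \<notin> R \<or> 4 \<notin> R" using av by auto
    then show ?thesis using excl[of 3 2] excl[of 3 4] by auto
  next
    case 3
    then have "1 \<notin> R" "3 \<notin> R \<or> 4 \<notin> R" using av by auto
    then show ?thesis using excl[of 1 3] excl[of 1 4] by auto
  next
    case 4
    then have "4 \<notin> R" "1 \<notin> R \<or> 2 \<notin> R" using av by auto
    then show ?thesis using excl[of 4 1] excl[of 4 2] by auto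
  next
    case 5
    then have "2 \<notin> R" "1 \<notin> R \<or> 3 \<notin> R" using av by auto
    then show ?thesis using excl[of 2 1] excl[of 2 3] by auto
  qed
qed

lemma card_missed_special_gaps_le_2:
  assumes S: "numerical_semigroup S" "5 \<in> S" and T: "irreducible_semigroup T" "S \<subseteq> T"
  shows "card (special_gaps S - T) \<le> 2"
\<comment> \<open>\<open>UNIV\<close> has no largest gap, but it also misses no special gap.\<close>
proof (cases "T = UNIV")
  case True
  then show ?thesis by simp
next
  case False
  have fin: "finite (- T)"
    using T unfolding irreducible_semigroup_def numerical_semigroup_def by blast
  define F where "F = Max (- T)"
  have F: "F \<notin> T" using Max_in[OF fin] False unfolding F_def by blast
  have F_max: "\<And>x. x \<notin> T \<Longrightarrow> x \<le> F" using Max_ge[OF fin] unfolding F_def by blast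
  let ?R = "(\<lambda>h. h mod 5) ` (special_gaps S - T)"
  have "card ?R \<le> 2"
  proof (rule card_residues_sum_avoiding_le_2[where r = "F mod 5"])
    show "?R \<subseteq> {1..4}"
    proof
      fix r assume "r \<in> ?R"
      then have "r < 5" "r \<noteq> 0" using special_gaps_mod_nonzero[OF S] by auto
      then show "r \<in> {1..4}" by simp
    qed
    show "F mod 5 < 5" by simp
    show "(a + b) mod 5 \<noteq> F mod 5" if a: "a \<in> ?R" and b: "b \<in> ?R" for a b
    proof -
      obtain h h' where "h \<in> special_gaps S - T" "h' \<in> special_gaps S - T"
        "a = h mod 5" "b = h' mod 5"
        using a b by blast
      then show ?thesis
        using irreducible_missed_special_gaps_mod[OF S(1,2) _ T F F_max, of h h']
        by (simp add: mod_add_eq)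
    qed
  qed
  moreover have "inj_on (\<lambda>h. h mod 5) (special_gaps S - T)"
    using special_gaps_inj_on_mod[OF S] by (rule inj_on_subset) blast
  ultimately show ?thesis by (simp add: card_image)
qed

section \<open>Decompositions as unordered families\<close>

definition irredundant_family :: "nat set \<Rightarrow> nat set set \<Rightarrow> bool" where
  "irredundant_family S C \<longleftrightarrow>
     finite C \<and> (\<forall>T\<in>C. irreducible_semigroup T) \<and> \<Inter>C = S \<and> (\<forall>D. D \<subset> C \<longrightarrow> \<Inter>D \<noteq> S)"

text \<open>Irredundancy makes the components distinct, so the indexing carries no information and
  the length is the number of members.\<close>

lemma decomposition_lengths_eq: "decomposition_lengths S = card ` Collect (irredundant_family S)"
proof (intro equalityI subsetI)
  fix k assume "k \<in> decomposition_lengths S"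
  then obtain T where T: "\<And>i. i \<in> {1..k} \<Longrightarrow> irreducible_semigroup (T i)"
    "S = (\<Inter>i\<in>{1..k}. T i)" "\<And>I. I \<subset> {1..k} \<Longrightarrow> S \<noteq> (\<Inter>i\<in>I. T i)"
    unfolding decomposition_lengths_def irreducible_decomposition_def by blast
  \<comment> \<open>A repeated component could be dropped from the index set without changing the
    intersection.\<close>
  have "inj_on T {1..k}"
  proof (rule inj_onI, rule ccontr)
    fix i j assume ij: "i \<in> {1..k}" "j \<in> {1..k}" "T i = T j" "i \<noteq> j"
    then have "T ` {1..k} = insert (T i) (T ` ({1..k} - {i}))" by blast
    moreover have "T i \<in> T ` ({1..k} - {i})" using ij by blast
    ultimately have "T ` ({1..k} - {i}) = T ` {1..k}" by (simp add: insert_absorb)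
    then have "S = (\<Inter>i\<in>{1..k} - {i}. T i)" using T(2) by simp
    moreover have "{1..k} - {i} \<subset> {1..k}" using ij by blast
    ultimately show False using T(3) by blast
  qed
  then have "card (T ` {1..k}) = k" by (simp add: card_image)
  moreover have "irredundant_family S (T ` {1..k})"
    unfolding irredundant_family_def
  proof (intro conjI allI impI)
    fix D assume D: "D \<subset> T ` {1..k}"
    define I where "I = {i \<in> {1..k}. T i \<in> D}"
    have "T ` I = D" "I \<subset> {1..k}" unfolding I_def using D by auto
    then show "\<Inter>D \<noteq> S" using T(3) by blast
  qed (use T in auto)
  ultimately show "k \<in> card ` Collect (irredundant_family S)" by force
next
  fix k assume "k \<in> card ` Collect (irredundant_family S)"
  then obtain C where C: "irredundant_family S C" "card C = k" by blast
  then have "finite C" unfolding irredundant_family_def by blast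
  then obtain T where bij: "bij_betw T {1..k} C"
    using ex_bij_betw_nat_finite_1 C(2) by blast
  then have im: "T ` {1..k} = C" and inj: "inj_on T {1..k}" unfolding bij_betw_def by auto
  have "irreducible_decomposition S k T"
    unfolding irreducible_decomposition_def
  proof (intro conjI allI impI)
    fix I assume I: "I \<subset> {1..k}"
    then have "T ` I \<subset> C"
      using image_strict_mono[OF inj] im by simp
    then show "S \<noteq> (\<Inter>i\<in>I. T i)" using C(1) unfolding irredundant_family_def by blast
  qed (use C(1) im in \<open>auto simp: irredundant_family_def\<close>)
  then show "k \<in> decomposition_lengths S" unfolding decomposition_lengths_def by blast
qed

text \<open>Splitting a reducible semigroup yields two semigroups with fewer gaps, so repeated
  splitting terminates.\<close>

lemma ex_irreducible_family:
  assumes "numerical_semigroup S"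
  shows "\<exists>C. finite C \<and> (\<forall>T\<in>C. irreducible_semigroup T) \<and> \<Inter>C = S"
  using assms
proof (induction "card (- S)" arbitrary: S rule: less_induct)
  case less
  show ?case
  proof (cases "irreducible_semigroup S")
    case True
    then show ?thesis by (intro exI[of _ "{S}"]) auto
  next
    case False
    then obtain T U where TU: "numerical_semigroup T" "numerical_semigroup U"
      "S \<subset> T" "S \<subset> U" "S = T \<inter> U"
      using less.prems unfolding irreducible_semigroup_def by blast
    have fin: "finite (- S)" using less.prems unfolding numerical_semigroup_def by blast
    have "card (- T) < card (- S)" "card (- U) < card (- S)"
      using TU(3,4) by (blast intro: psubset_card_mono[OF fin])+
    then obtain C D where "finite C \<and> (\<forall>T\<in>C. irreducible_semigroup T) \<and> \<Inter>C = T"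
      "finite D \<and> (\<forall>T\<in>D. irreducible_semigroup T) \<and> \<Inter>D = U"
      using less.hyps TU by meson
    then show ?thesis using TU(5) by (intro exI[of _ "C \<union> D"]) auto
  qed
qed

lemma ex_irredundant_family:
  assumes "numerical_semigroup S"
  shows "\<exists>C. irredundant_family S C"
proof -
  let ?P = "\<lambda>C. finite C \<and> (\<forall>T\<in>C. irreducible_semigroup T) \<and> \<Inter>C = S"
  \<comment> \<open>A family of least cardinality is irredundant.\<close>
  obtain C where C: "?P C" "\<And>D. ?P D \<Longrightarrow> card C \<le> card D"
    using ex_has_least_nat[of ?P _ card] ex_irreducible_family[OF assms] by metis
  have "\<Inter>D \<noteq> S" if "D \<subset> C" for D
  proof
    assume "\<Inter>D = S"
    moreover have "finite D" "\<forall>T\<in>D. irreducible_semigroup T"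
      using C(1) that by (auto intro: finite_subset)
    ultimately have "card C \<le> card D" using C(2) by blast
    then show False using psubset_card_mono[of C D] C(1) that by linarith
  qed
  then show ?thesis using C(1) unfolding irredundant_family_def by blast
qed

text \<open>Without \<open>T\<close> the family no longer covers all special gaps, so some special
  gap is missed by \<open>T\<close> alone; choose it as \<open>p T\<close>.\<close>

lemma irredundant_family_private_gaps:
  assumes "numerical_semigroup S" "irredundant_family S C"
  shows "\<exists>p. inj_on p C \<and>
    (\<forall>T\<in>C. p T \<in> special_gaps S - T \<and> (\<forall>U\<in>C - {T}. p T \<in> U))"
proof -
  have C: "\<And>T. T \<in> C \<Longrightarrow> numerical_semigroup T \<and> S \<subseteq> T" "\<Inter>C = S" "\<And>D. D \<subset> C \<Longrightarrow> \<Inter>D \<noteq> S"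
    using assms(2) unfolding irredundant_family_def irreducible_semigroup_def by blast+
  have "\<exists>h. h \<in> special_gaps S - T \<and> (\<forall>U\<in>C - {T}. h \<in> U)" if T: "T \<in> C" for T
  proof -
    have "\<Inter>(C - {T}) \<noteq> S" using C(3) T by blast
    moreover have "\<Inter>(C - {T}) = S \<longleftrightarrow> (\<forall>h\<in>special_gaps S. \<exists>U\<in>C - {T}. h \<notin> U)"
      by (rule Inter_eq_iff_special_gaps[OF assms(1)]) (rule C(1), simp)
    ultimately obtain h where h: "h \<in> special_gaps S" "\<forall>U\<in>C - {T}. h \<in> U" by metis
    moreover have "h \<notin> T"
      using h C(2) unfolding special_gaps_def by blast
    ultimately show ?thesis by blast
  qed
  then obtain p where p: "\<And>T. T \<in> C \<Longrightarrow> p T \<in> special_gaps S - T \<and> (\<forall>U\<in>C - {T}. p T \<in> U)"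
    by metis
  moreover have "inj_on p C"
  proof (rule inj_onI, rule ccontr)
    fix T U assume "T \<in> C" "U \<in> C" "p T = p U" "T \<noteq> U"
    then show False using p[of T] p[of U] by auto
  qed
  ultimately show ?thesis by blast
qed

section \<open>Bounds on the length, and the construction of length 3\<close>

lemma card_irredundant_family_le:
  assumes "numerical_semigroup S" "irredundant_family S C"
  shows "card C \<le> card (special_gaps S)"
proof -
  obtain p where p: "inj_on p C" "\<forall>T\<in>C. p T \<in> special_gaps S - T"
    using irredundant_family_private_gaps[OF assms] by blast
  then show ?thesis
    by (intro card_inj_on_le[OF p(1)] finite_special_gaps[OF assms(1)]) blast
qed

lemma special_gaps_eq_missed:
  assumes "\<Inter>C = S"
  shows "special_gaps S = (\<Union>T\<in>C. special_gaps S - T)"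
  using assms unfolding special_gaps_def by blast

lemma card_irredundant_family_ge:
  assumes "numerical_semigroup S" "5 \<in> S" "irredundant_family S C"
  shows "card (special_gaps S) \<le> 2 * card C"
proof -
  have C: "finite C" "\<Inter>C = S" "\<And>T. T \<in> C \<Longrightarrow> irreducible_semigroup T \<and> S \<subseteq> T"
    using assms(3) unfolding irredundant_family_def by blast+
  have "card (special_gaps S) \<le> (\<Sum>T\<in>C. card (special_gaps S - T))"
    using card_UN_le[OF C(1), of "\<lambda>T. special_gaps S - T"] special_gaps_eq_missed[OF C(2)] by simp
  also have "\<dots> \<le> (\<Sum>T\<in>C. 2)"
    using card_missed_special_gaps_le_2[OF assms(1,2)] C(3) by (intro sum_mono) blast
  finally show ?thesis by simp
qed

text \<open>The members of \<open>C\<close> miss two disjoint pairs of special gaps, while each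
  member of \<open>D\<close> misses a single one. Keep \<open>U\<close>, and replace
  \<open>V\<close> by the members of \<open>D\<close> that miss the two gaps of \<open>V\<close> one
  at a time.\<close>

lemma irredundant_family_card_3:
  assumes S: "numerical_semigroup S" "5 \<in> S" and n: "card (special_gaps S) = 4"
    and C: "irredundant_family S C" "card C = 2" and D: "irredundant_family S D" "card D = 4"
  shows "\<exists>E. irredundant_family S E \<and> card E = 3"
proof -
  let ?M = "\<lambda>T. special_gaps S - T"
  note fin = finite_special_gaps[OF S(1)]
  obtain U V where UV: "C = {U, V}" "U \<noteq> V" using C(2) by (auto simp: card_2_iff)
  have irr: "irreducible_semigroup U" "irreducible_semigroup V" and sub: "S \<subseteq> U" "S \<subseteq> V"
    and int: "\<Inter>C = S"
    using C(1) UV unfolding irredundant_family_def by auto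
  have un: "special_gaps S = ?M U \<union> ?M V"
    using special_gaps_eq_missed[OF int] unfolding UV(1) by blast
  have le: "card (?M U) \<le> 2" "card (?M V) \<le> 2"
    using card_missed_special_gaps_le_2[OF S] irr sub by blast+
  have sum: "card (?M U) + card (?M V) = card (?M U \<union> ?M V) + card (?M U \<inter> ?M V)"
    using fin by (intro card_Un_Int) auto
  \<comment> \<open>Two sets of size at most 2 cover four gaps, which forces equality and
    disjointness.\<close>
  have card2: "card (?M U) = 2" "card (?M V) = 2" and "card (?M U \<inter> ?M V) = 0"
    using sum le n un by simp_all
  then have disj: "?M U \<inter> ?M V = {}" using fin by simp
  obtain a b where ab: "?M V = {a, b}" "a \<noteq> b" using card2(2) by (auto simp: card_2_iff)
  \<comment> \<open>The gap \<open>c\<close> will show that \<open>U\<close> cannot be dropped from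
    the new family.\<close>
  have "?M U \<noteq> {}" using card2(1) by (metis card.empty zero_neq_numeral)
  then obtain c where c: "c \<in> ?M U" by blast

  obtain p where p: "inj_on p D" "\<forall>T\<in>D. p T \<in> ?M T \<and> (\<forall>W\<in>D - {T}. p T \<in> W)"
    using irredundant_family_private_gaps[OF S(1) D(1)] by blast
  \<comment> \<open>An injection from four members into four special gaps is onto, so every special
    gap is private to one member of \<open>D\<close>.\<close>
  have pD: "p ` D = special_gaps S"
    using p fin D(2) n by (intro card_subset_eq) (auto simp: card_image)
  have singleton: "\<exists>T\<in>D. ?M T = {h}" if h: "h \<in> special_gaps S" for h
  proof -
    obtain T where T: "T \<in> D" "h = p T" using h pD by blast
    have "g \<in> T" if "g \<in> special_gaps S" "g \<noteq> h" for g
    proof -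
      obtain W where "W \<in> D" "g = p W" using \<open>g \<in> special_gaps S\<close> pD by blast
      then show ?thesis using p(2) T that(2) by blast
    qed
    then have "?M T = {h}" using T p(2) by blast
    then show ?thesis using T(1) by blast
  qed
  have "a \<in> special_gaps S" "b \<in> special_gaps S" using ab by blast+
  then obtain A B where AB: "A \<in> D" "?M A = {a}" "B \<in> D" "?M B = {b}" using singleton by meson
  let ?E = "{U, A, B}"
  have ne: "A \<noteq> B" "U \<noteq> A" "U \<noteq> B" using AB ab card2(1) by auto
  have "irreducible_semigroup T \<and> S \<subseteq> T" if "T \<in> D" for T
    using that D(1) unfolding irredundant_family_def by blast
  then have irrE: "irreducible_semigroup T \<and> S \<subseteq> T" if "T \<in> ?E" for T
    using that irr(1) sub(1) AB(1,3) by fast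
  have nsE: "numerical_semigroup T \<and> S \<subseteq> T" if "T \<in> ?E" for T
    using irrE[OF that] unfolding irreducible_semigroup_def by simp
  have A: "h \<in> A" if "h \<in> special_gaps S" "h \<noteq> a" for h using AB(2) that by blast
  have B: "h \<in> B" if "h \<in> special_gaps S" "h \<noteq> b" for h using AB(4) that by blast
  have "c \<in> special_gaps S" "a \<notin> ?M U" "b \<notin> ?M U" "c \<noteq> a" "c \<noteq> b"
    using c ab(1) disj by auto
  note gaps = this \<open>a \<in> special_gaps S\<close> \<open>b \<in> special_gaps S\<close>
  have inside: "c \<in> A" "c \<in> B" "a \<in> U" "a \<in> B" "b \<in> U" "b \<in> A"
    using gaps ab(2) A B by auto
  have "irredundant_family S ?E"
    unfolding irredundant_family_def
  proof (intro conjI allI impI ballI)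
    have missed: "\<exists>T\<in>?E. h \<notin> T" if "h \<in> special_gaps S" for h
    proof -
      have "h \<in> ?M U \<or> h \<in> ?M A \<or> h \<in> ?M B" using that un ab(1) AB(2,4) by auto
      then show ?thesis by auto
    qed
    have "\<Inter>?E = S \<longleftrightarrow> (\<forall>h\<in>special_gaps S. \<exists>T\<in>?E. h \<notin> T)"
      by (rule Inter_eq_iff_special_gaps[OF S(1)]) (rule nsE)
    then show "\<Inter>?E = S" using missed by (rule iffD2[OF _ ballI])
  next
    fix G assume G: "G \<subset> ?E"
    then obtain X where "X \<in> ?E" and X: "X \<notin> G" by (meson psubset_imp_ex_mem DiffD1 DiffD2)
    have cover: "T = U \<or> T = A \<or> T = B" if "T \<in> G" for T
      using subsetD[OF psubset_imp_subset[OF G] that] by simp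
    consider "X = U" | "X = A" | "X = B" using \<open>X \<in> ?E\<close> by fast
    \<comment> \<open>The gap missed only by the omitted member \<open>X\<close> survives in the
      intersection.\<close>
    then have "c \<in> \<Inter>G \<or> a \<in> \<Inter>G \<or> b \<in> \<Inter>G"
    proof cases
      case 1
      then have "\<forall>T\<in>G. T = A \<or> T = B" using X cover by metis
      then show ?thesis using inside(1,2) by (metis InterI)
    next
      case 2
      then have "\<forall>T\<in>G. T = U \<or> T = B" using X cover by metis
      then show ?thesis using inside(3,4) by (metis InterI)
    next
      case 3
      then have "\<forall>T\<in>G. T = U \<or> T = A" using X cover by metis
      then show ?thesis using inside(5,6) by (metis InterI)
    qed
    then show "\<Inter>G \<noteq> S" using gaps unfolding special_gaps_def by auto
  next
    show "irreducible_semigroup T" if "T \<in> ?E" for T using irrE[OF that] by simp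
  qed simp
  moreover have "card ?E = 3" using ne by simp
  ultimately show ?thesis by blast
qed

theorem theorem3p3:
  fixes S :: "nat set"
  assumes "numerical_semigroup S" and "multiplicity S = 5"
  shows "integer_interval (int ` decomposition_lengths S)"
proof -
  let ?L = "decomposition_lengths S" and ?n = "card (special_gaps S)"
  \<comment> \<open>The \<open>LEAST\<close> in \<open>multiplicity\<close> yields an element of
    \<open>S\<close> only if a positive one exists.\<close>
  have "\<exists>x. 0 < x \<and> x \<in> S"
  proof (rule ccontr)
    assume "\<not> ?thesis"
    then have "{0<..} \<subseteq> - S" by blast
    then have "finite {0::nat<..}" using assms(1) unfolding numerical_semigroup_def
      by (blast intro: finite_subset)
    then show False using infinite_Ioi by blast
  qed
  then have S5: "5 \<in> S"
    using LeastI_ex[of "\<lambda>x. 0 < x \<and> x \<in> S"] assms(2) unfolding multiplicity_def by simp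
  have n4: "?n \<le> 4" using card_special_gaps_le_4[OF assms(1) S5] .
  have bounds: "?n \<le> 2 * k \<and> k \<le> ?n" if "k \<in> ?L" for k
    using that card_irredundant_family_le[OF assms(1)] card_irredundant_family_ge[OF assms(1) S5]
    unfolding decomposition_lengths_eq by auto
  have no_hole: "3 \<in> ?L" if "2 \<in> ?L" "4 \<in> ?L"
  proof -
    obtain C D where CD: "irredundant_family S C" "card C = 2" "irredundant_family S D" "card D = 4"
      using \<open>2 \<in> ?L\<close> \<open>4 \<in> ?L\<close> unfolding decomposition_lengths_eq by force
    have "?n = 4" using bounds[OF that(2)] n4 by linarith
    then obtain E where "irredundant_family S E" "card E = 3"
      using irredundant_family_card_3[OF assms(1) S5 _ CD] by blast
    then show ?thesis unfolding decomposition_lengths_eq by force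
  qed
  have ne: "?L \<noteq> {}"
    using ex_irredundant_family[OF assms(1)] unfolding decomposition_lengths_eq by blast
  have fin: "finite ?L" using bounds by (intro finite_subset[of ?L "{..?n}"]) auto
  define a b where "a = Min ?L" and "b = Max ?L"
  have ab: "a \<in> ?L" "b \<in> ?L" "\<And>k. k \<in> ?L \<Longrightarrow> a \<le> k \<and> k \<le> b"
    unfolding a_def b_def using fin ne by auto
  have between: "k \<in> ?L" if "a \<le> k" "k \<le> b" for k
  proof (cases "k = a \<or> k = b")
    case True
    then show ?thesis using ab by auto
  next
    case False
    then have "a < k" "k < b" using that by auto
    \<comment> \<open>From \<open>b \<le> ?n \<le> 2 * a\<close>, \<open>?n \<le> 4\<close> and
      \<open>a + 2 \<le> b\<close>, only this case remains.\<close>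
    then have "k = 3 \<and> a = 2 \<and> b = 4"
      using bounds[OF ab(1)] bounds[OF ab(2)] n4 by linarith
    then show ?thesis using no_hole ab by simp
  qed
  have "?L = {a..b}" using ab(3) between by (meson atLeastAtMost_iff equalityI subsetI)
  then have "int ` ?L = {int a..int b}" by (simp add: image_int_atLeastAtMost)
  then have "int ` ?L = {n. int a \<le> n \<and> n \<le> int b}"
    unfolding atLeastAtMost_def atLeast_def atMost_def by (simp add: Collect_conj_eq)
  moreover have "int a \<le> int b" using ab by simp
  ultimately show ?thesis unfolding integer_interval_def by blast
qed

end
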